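(* For any fixed integer $k>1$, the sequence $\{\mathrm{BoNa}(n,k)\}_{n\geq k+1}$ is log-concave.
   Context: A binary plane tree is a rooted plane tree on unlabeled vertices in which every non-leaf vertex has one or two children, and every child is a left child or a right child, even if it is the only child of its parent. A 0-1-tree is a binary plane tree in which every vertex that has two children is labeled 0 or 1 (no other vertex is labeled). A right edge is an edge connecting a vertex to its right child. For $n\ge 1$, the Boolean-Narayana number $\mathrm{BoNa}(n,k)$ is the number of 0-1-trees on $n$ vertices that have exactly $k-1$ right edges. A sequence $a_1,a_2,\ldots$ (finite or infinite) of nonnegative real numbers is log-concave if $a_{i-1}a_{i+1}\leq a_i^2$ for every index $i$ for which $a_{i-1}$, $a_i$ and $a_{i+1}$ are all terms of the sequence. *)

theory Defs
  imports Complex_Main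
begin

(* Each constructor is a root vertex: childless, with only a left child, with only a right
   child, or with both children, in which case alone the root carries a label
   (False is 0, True is 1). There is no empty tree. *)
datatype zero_one_tree =
    Leaf
  | Left_Only zero_one_tree
  | Right_Only zero_one_tree
  | Both bool zero_one_tree zero_one_tree

primrec num_vertices :: "zero_one_tree \<Rightarrow> nat" where
  "num_vertices Leaf = 1"
| "num_vertices (Left_Only l) = num_vertices l + 1"
| "num_vertices (Right_Only r) = num_vertices r + 1"
| "num_vertices (Both b l r) = num_vertices l + num_vertices r + 1"

primrec num_right_edges :: "zero_one_tree \<Rightarrow> nat" where
  "num_right_edges Leaf = 0"
| "num_right_edges (Left_Only l) = num_right_edges l"
| "num_right_edges (Right_Only r) = num_right_edges r + 1"
| "num_right_edges (Both b l r) = num_right_edges l + num_right_edges r + 1"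

(* "Exactly k - 1 right edges" is written additively to avoid truncated subtraction at k = 0. *)
definition BoNa :: "nat \<Rightarrow> nat \<Rightarrow> nat" where
  "BoNa n k = card {t. num_vertices t = n \<and> num_right_edges t + 1 = k}"

(* The cardinality in BoNa is that of a finite set. *)
lemma finite_num_vertices_le: "finite {t. num_vertices t \<le> n}"
proof (induction n)
  case 0
  have "\<not> num_vertices t \<le> 0" for t by (cases t) auto
  then have "{t. num_vertices t \<le> 0} = {}" by blast
  then show ?case by (simp only: finite.emptyI)
next
  case (Suc n)
  let ?S = "{t. num_vertices t \<le> n}"
  let ?U = "{Leaf} \<union> Left_Only ` ?S \<union> Right_Only ` ?S
      \<union> (\<lambda>(b, l, r). Both b l r) ` (UNIV \<times> ?S \<times> ?S)"
  have "t \<in> ?U" if "num_vertices t \<le> Suc n" for t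
    using that by (cases t) (auto simp: image_iff)
  then have "{t. num_vertices t \<le> Suc n} \<subseteq> ?U" by blast
  moreover have "finite ?U" using Suc.IH by simp
  ultimately show ?case by (rule finite_subset)
qed

(* The sequence consists of the terms a i with i in the index set I. The middle index is
   written Suc i, so that no predecessor is taken at 0. *)
definition log_concave_on :: "nat set \<Rightarrow> (nat \<Rightarrow> real) \<Rightarrow> bool" where
  "log_concave_on I a \<longleftrightarrow>
     (\<forall>i\<in>I. 0 \<le> a i) \<and>
     (\<forall>i. i \<in> I \<and> Suc i \<in> I \<and> Suc (Suc i) \<in> I \<longrightarrow> a i * a (Suc (Suc i)) \<le> (a (Suc i))\<^sup>2)"

end

theory Submission
  imports Defs "HOL-Computational_Algebra.Polynomial"
begin

text \<open>
  Splitting off the root, the generating function \<open>T\<close> of 0-1-trees (\<open>x\<close> marking vertices, \<open>u\<close>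
  marking right edges) satisfies \<open>T = x (1 + (1 + u) T + 2 u T^2)\<close>, and Lagrange inversion yields
  \<open>n BoNa(n, p + 1) = (n choose p) S p (n - p)\<close>, where
  \<open>S p m = [t^(m - 1)] (1 + t)^m (1 + 2 t)^p\<close>. Lagrange inversion is proved by induction on the
  number of vertices for ordered forests of \<open>r\<close> trees, that is, for all powers of \<open>T\<close> at once.

  The numbers \<open>S p m\<close> obey the Delannoy recurrence, so \<open>S (p + 1)\<close> arises from \<open>S p\<close> by
  adding adjacent terms and then taking partial sums, two operations that preserve log-concavity;
  and \<open>S 0 m = m\<close>. The remaining factor \<open>(n choose p) / n\<close> is log-concave by direct
  computation, and products of log-concave sequences are log-concave.
\<close>

section \<open>Root decomposition of ordered forests\<close>

text \<open>As in \<open>BoNa\<close>, a forest counted at \<open>k\<close> has \<open>k - 1\<close> right edges. The empty value at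
  \<open>k = 0\<close> makes the recurrences below uniform in \<open>k\<close>.\<close>
definition forests :: "nat \<Rightarrow> nat \<Rightarrow> nat \<Rightarrow> zero_one_tree list set" where
  "forests r n k = {ts. length ts = r \<and> sum_list (map num_vertices ts) = n
     \<and> sum_list (map num_right_edges ts) + 1 = k}"

lemma forests_0_right [simp]: "forests r n 0 = {}"
  by (simp add: forests_def)

lemma finite_forests: "finite (forests r n k)"
proof (rule finite_subset)
  show "forests r n k \<subseteq> {ts. set ts \<subseteq> {t. num_vertices t \<le> n} \<and> length ts = r}"
    by (auto simp: forests_def intro!: member_le_sum_list)
  show "finite {ts. set ts \<subseteq> {t. num_vertices t \<le> n} \<and> length ts = r}"
    by (rule finite_lists_length_eq[OF finite_num_vertices_le])
qed

lemma num_vertices_neq_0 [simp]: "num_vertices t \<noteq> 0"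
  by (cases t) auto

lemma card_forests_no_trees: "card (forests 0 n k) = (if n = 0 \<and> k = 1 then 1 else 0)"
proof -
  have "forests 0 n k = (if n = 0 \<and> k = 1 then {[]} else {})"
    by (auto simp: forests_def)
  then show ?thesis by simp
qed

lemma forests_no_vertices: "forests (Suc r) 0 k = {}"
  by (auto simp: forests_def length_Suc_conv)

text \<open>The root of the first tree is removed: a leaf leaves \<open>r\<close> trees, an only
  child takes its parent's place, and two children become two trees, the factor 2 counting labels.
  Losing a right edge lowers the index from \<open>Suc k\<close> to \<open>k\<close>.\<close>

lemma card_forests_rec:
  "card (forests (Suc r) (Suc n) (Suc k)) =
     card (forests r n (Suc k)) + card (forests (Suc r) n (Suc k))
       + card (forests (Suc r) n k) + 2 * card (forests (Suc (Suc r)) n k)"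
proof -
  let ?L = "\<lambda>ts. Left_Only (hd ts) # tl ts"
  let ?R = "\<lambda>ts. Right_Only (hd ts) # tl ts"
  let ?B = "\<lambda>b ts. Both b (hd ts) (hd (tl ts)) # tl (tl ts)"
  let ?S1 = "Cons Leaf ` forests r n (Suc k)"
  let ?S2 = "?L ` forests (Suc r) n (Suc k)"
  let ?S3 = "?R ` forests (Suc r) n k"
  let ?S4 = "\<lambda>b. ?B b ` forests (Suc (Suc r)) n k"
  have eq: "forests (Suc r) (Suc n) (Suc k) = ?S1 \<union> ?S2 \<union> ?S3 \<union> ?S4 False \<union> ?S4 True"
  proof (intro equalityI subsetI)
    fix ts assume ts: "ts \<in> forests (Suc r) (Suc n) (Suc k)"
    then obtain t us where us: "ts = t # us" by (auto simp: forests_def length_Suc_conv)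
    show "ts \<in> ?S1 \<union> ?S2 \<union> ?S3 \<union> ?S4 False \<union> ?S4 True"
    proof (cases t)
      case Leaf
      then have "us \<in> forests r n (Suc k)" using ts us by (simp add: forests_def)
      then show ?thesis using us Leaf by blast
    next
      case (Left_Only l)
      then have "l # us \<in> forests (Suc r) n (Suc k)" using ts us by (simp add: forests_def)
      moreover have "ts = ?L (l # us)" using us Left_Only by simp
      ultimately show ?thesis by blast
    next
      case (Right_Only l)
      then have "l # us \<in> forests (Suc r) n k" using ts us by (simp add: forests_def)
      moreover have "ts = ?R (l # us)" using us Right_Only by simp
      ultimately show ?thesis by blast
    next
      case (Both b l l')
      then have "l # l' # us \<in> forests (Suc (Suc r)) n k" using ts us by (simp add: forests_def)
      moreover have "ts = ?B b (l # l' # us)" using us Both by simp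
      ultimately show ?thesis by (cases b) blast+
    qed
  next
    fix ts assume "ts \<in> ?S1 \<union> ?S2 \<union> ?S3 \<union> ?S4 False \<union> ?S4 True"
    then show "ts \<in> forests (Suc r) (Suc n) (Suc k)"
      by (auto simp: forests_def length_Suc_conv)
  qed
  \<comment> \<open>\<open>hd\<close> and \<open>tl\<close> determine a list only when it is long
    enough, which is what makes the maps injective.\<close>
  have shape: "\<exists>t us. ts = t # us" if "ts \<in> forests (Suc r) n' k'" for ts r n' k'
    using that by (auto simp: forests_def length_Suc_conv)
  have shape2: "\<exists>t t' us. ts = t # t' # us" if "ts \<in> forests (Suc (Suc r)) n' k'" for ts n' k'
    using that by (auto simp: forests_def length_Suc_conv)
  have c2: "card ?S2 = card (forests (Suc r) n (Suc k))"
    by (rule card_image, rule inj_onI) (auto dest!: shape)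
  have c3: "card ?S3 = card (forests (Suc r) n k)"
    by (rule card_image, rule inj_onI) (auto dest!: shape)
  have c4: "card (?S4 b) = card (forests (Suc (Suc r)) n k)" for b
    by (rule card_image, rule inj_onI) (auto dest!: shape2)
  have c1: "card ?S1 = card (forests r n (Suc k))"
    by (rule card_image) simp
  have "card (forests (Suc r) (Suc n) (Suc k))
      = card ?S1 + card ?S2 + card ?S3 + card (?S4 False) + card (?S4 True)"
    unfolding eq by (subst card_Un_disjoint; (auto simp: finite_forests)[1])+
  then show ?thesis by (simp add: c1 c2 c3 c4)
qed

lemma BoNa_eq_card_forests: "BoNa n k = card (forests 1 n k)"
proof -
  have "forests 1 n k = (\<lambda>t. [t]) ` {t. num_vertices t = n \<and> num_right_edges t + 1 = k}"
    by (auto simp: forests_def length_Suc_conv)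
  then show ?thesis by (simp add: BoNa_def card_image inj_on_def)
qed

section \<open>Lagrange inversion\<close>

text \<open>The coefficient of \<open>u ^ (k - 1)\<close> in \<open>(A + u * B) ^ n\<close>.\<close>
fun binom_coeff :: "real poly \<Rightarrow> real poly \<Rightarrow> nat \<Rightarrow> nat \<Rightarrow> real poly" where
  "binom_coeff A B n 0 = 0"
| "binom_coeff A B 0 (Suc k) = (if k = 0 then 1 else 0)"
| "binom_coeff A B (Suc n) (Suc k) = A * binom_coeff A B n (Suc k) + B * binom_coeff A B n k"

lemma binom_coeff_eq_0: "binom_coeff A B n (Suc (n + Suc d)) = 0"
proof (induction n arbitrary: d)
  case (Suc n)
  show ?case using Suc[of d] Suc[of "Suc d"] by simp
qed simp

lemma binom_coeff_closed_form:
  "binom_coeff A B (m + p) (Suc p) = of_nat ((m + p) choose p) * A ^ m * B ^ p"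
proof (induction "m + p" arbitrary: m p)
  case (Suc n)
  show ?case
  proof (cases p)
    case 0
    then obtain m' where "m = Suc m'" "n = m'" using Suc.hyps(2) by (cases m) auto
    then show ?thesis using 0 Suc.hyps(1)[of m' 0] by simp
  next
    case p: (Suc q)
    have q: "binom_coeff A B (m + q) (Suc q) = of_nat ((m + q) choose q) * A ^ m * B ^ q"
      using Suc p by simp
    show ?thesis
    proof (cases m)
      case 0
      then show ?thesis using q p binom_coeff_eq_0[of A B q 0] by simp
    next
      case (Suc m')
      have "binom_coeff A B (m' + p) (Suc p) = of_nat ((m' + p) choose p) * A ^ m' * B ^ p"
        using \<open>Suc n = m + p\<close> Suc Suc.hyps(1)[of m' p] by simp
      with q show ?thesis using Suc p by (simp add: algebra_simps)
    qed
  qed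
qed simp

text \<open>Coefficient of \<open>u ^ k\<close> in the chain rule for
  \<open>(A + u * B) ^ (n + 1)\<close>, with \<open>u\<close> constant.\<close>

lemma pderiv_binom_coeff:
  "pderiv (binom_coeff A B (Suc n) (Suc k)) =
     of_nat (Suc n) * (pderiv A * binom_coeff A B n (Suc k) + pderiv B * binom_coeff A B n k)"
proof (induction n arbitrary: k)
  case 0
  show ?case by (cases k) (auto simp: pderiv_add pderiv_mult)
next
  case (Suc n)
  have product_rule: "pderiv (binom_coeff A B (Suc (Suc n)) (Suc k)) =
      pderiv A * binom_coeff A B (Suc n) (Suc k) + pderiv B * binom_coeff A B (Suc n) k
      + A * pderiv (binom_coeff A B (Suc n) (Suc k)) + B * pderiv (binom_coeff A B (Suc n) k)"
    by (simp add: pderiv_add pderiv_mult algebra_simps del: binom_coeff.simps(3)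
          add: binom_coeff.simps(3)[of A B "Suc n"])
  have IH: "A * pderiv (binom_coeff A B (Suc n) (Suc k)) + B * pderiv (binom_coeff A B (Suc n) k)
      = of_nat (Suc n) * (pderiv A * binom_coeff A B (Suc n) (Suc k) + pderiv B * binom_coeff A B (Suc n) k)"
  proof (cases k)
    case 0
    show ?thesis unfolding Suc 0 by (simp add: algebra_simps)
  next
    case k: (Suc k')
    show ?thesis unfolding k Suc by (simp add: algebra_simps)
  qed
  show ?case unfolding product_rule add.assoc IH
    by (simp add: algebra_simps del: binom_coeff.simps)
qed

abbreviation weight :: "nat \<Rightarrow> nat \<Rightarrow> real poly" where
  "weight \<equiv> binom_coeff [:1, 1:] [:0, 1, 2:]"

text \<open>Lagrange inversion: the equation \<open>T = x * (1 + T + u * T * (1 + 2 * T))\<close> gives \<open>[x ^ n] T ^ r = (r / n) [t ^ (n - r)] (1 + t + u * t * (1 + 2 * t)) ^ n\<close>; the factor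
  \<open>monom 1 r\<close> replaces the truncated subtraction \<open>n - r\<close>.\<close>
lemma lagrange_forests:
  "real n * real (card (forests r n k)) = real r * coeff (monom 1 r * weight n k) n"
proof (cases "n = 0")
  case True
  then show ?thesis by (cases r) (auto simp: coeff_monom_mult)
next
  case False
  then show ?thesis
  proof (induction n arbitrary: r k)
    case (Suc n)
    show ?case
    proof (cases "r = 0 \<or> k = 0")
      case True
      then show ?thesis by (auto simp: card_forests_no_trees)
    next
      case False
      then obtain s j where s: "r = Suc s" and j: "k = Suc j"
        by (metis not0_implies_Suc)
      show ?thesis
      proof (cases "n = 0")
        \<comment> \<open>At zero vertices the factor \<open>real n\<close> hides the cardinality,
          so the induction starts from forests with one vertex, counted directly.\<close>
        case True
        show ?thesis unfolding s j True card_forests_rec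
          by (cases s; cases j) (auto simp: card_forests_no_trees forests_no_vertices coeff_monom_mult)
      next
        case n: False
        define W where "W = weight (Suc n) (Suc j)"
        define W1 where "W1 = weight n (Suc j)"
        define W0 where "W0 = weight n j"
        define M where "M = (monom 1 s :: real poly)"
        have W: "W = [:1, 1:] * W1 + [:0, 1, 2:] * W0"
          by (simp add: W_def W1_def W0_def)
        have W': "pderiv W = of_nat (Suc n) * (W1 + [:1, 4:] * W0)"
          unfolding W_def W1_def W0_def pderiv_binom_coeff by (simp add: pderiv_pCons)
        have MS: "monom 1 (Suc s) = [:0, 1:] * M" "monom 1 (Suc (Suc s)) = [:0, 1:] * [:0, 1:] * M"
          by (simp_all add: M_def monom_Suc)
        \<comment> \<open>\<open>M\<close> is \<open>t ^ s\<close>, so \<open>t * d/dt\<close>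
          multiplies it by \<open>s\<close>; \<open>xd\<close> below is the same fact read off
          coefficientwise.\<close>
        have M': "[:0, 1:] * pderiv M = of_nat s * M"
          by (cases s) (simp_all add: M_def pderiv_monom of_nat_poly smult_monom flip: monom_Suc)
        have co: "coeff (of_nat a * q) b = real a * coeff q b" for a b q
          by (simp add: of_nat_poly)
        have xd: "coeff ([:0, 1:] * pderiv q) n = real n * coeff q n" for q :: "real poly"
          using n by (cases n) (simp_all add: coeff_pderiv)
        \<comment> \<open>The forest recurrence times \<open>n\<close>, with the hypothesis for
          \<open>s\<close>, \<open>s + 1\<close>, \<open>s + 1\<close> and \<open>s + 2\<close>
          trees.\<close>
        have "real n * real (card (forests r (Suc n) k))
          = coeff (of_nat s * (M * W1) + of_nat (Suc s) * ([:0, 1:] * M * W1)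
             + of_nat (Suc s) * ([:0, 1:] * M * W0)
             + of_nat (2 * Suc (Suc s)) * ([:0, 1:] * [:0, 1:] * M * W0)) n"
          unfolding s j card_forests_rec coeff_add co
          using Suc.IH[OF n, of s "Suc j"] Suc.IH[OF n, of "Suc s" "Suc j"]
            Suc.IH[OF n, of "Suc s" j] Suc.IH[OF n, of "Suc (Suc s)" j]
          unfolding MS W1_def[symmetric] W0_def[symmetric] M_def[symmetric]
          by (simp add: algebra_simps del: mult_pCons_left mult_pCons_right)
        \<comment> \<open>Once \<open>s * M * W\<close> is split off, the remaining bracket is
          \<open>pderiv W / (n + 1)\<close> by \<open>W'\<close>; hence the later factor
          \<open>Suc n\<close>.\<close>
        also have "of_nat s * (M * W1) + of_nat (Suc s) * ([:0, 1:] * M * W1)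
             + of_nat (Suc s) * ([:0, 1:] * M * W0)
             + of_nat (2 * Suc (Suc s)) * ([:0, 1:] * [:0, 1:] * M * W0)
           = of_nat s * (M * W) + [:0, 1:] * M * (W1 + [:1, 4:] * W0)"
        proof -
          have l: "[:1, 1:] = 1 + [:0, 1 :: real:]" "[:0, 1, 2:] = [:0, 1:] + 2 * [:0, 1:] * [:0, 1 :: real:]"
            "[:1, 4:] = 1 + 4 * [:0, 1 :: real:]"
            by (simp_all add: numeral_poly one_pCons)
          show ?thesis unfolding W l
            by (simp add: algebra_simps del: mult_pCons_left mult_pCons_right)
        qed
        finally have eq: "real n * real (card (forests r (Suc n) k))
          = coeff (of_nat s * (M * W) + [:0, 1:] * M * (W1 + [:1, 4:] * W0)) n" .
        have "real (Suc n) * (real n * real (card (forests r (Suc n) k)))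
          = coeff (of_nat (Suc n) * (of_nat s * (M * W) + [:0, 1:] * M * (W1 + [:1, 4:] * W0))) n"
          unfolding eq co ..
        also have "of_nat (Suc n) * (of_nat s * (M * W) + [:0, 1:] * M * (W1 + [:1, 4:] * W0))
          = of_nat (Suc n * s) * (M * W) + [:0, 1:] * M * pderiv W"
          unfolding W' of_nat_mult by (simp only: algebra_simps)
        \<comment> \<open>Product rule with \<open>M'\<close>. The coefficient of
          \<open>M * W\<close> at \<open>n\<close> then carries
          \<open>(n + 1) * s - s + n = n * (s + 1)\<close>.\<close>
        also have "[:0, 1:] * M * pderiv W = [:0, 1:] * pderiv (M * W) - of_nat s * (M * W)"
          unfolding pderiv_mult mult.assoc[symmetric] M'[symmetric]
          by (simp add: algebra_simps del: mult_pCons_left mult_pCons_right)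
        finally have "real (Suc n) * (real n * real (card (forests r (Suc n) k)))
          = real n * (real (Suc s) * coeff (M * W) n)"
          unfolding coeff_add coeff_diff xd co by (simp add: algebra_simps)
        then have "real (Suc n) * real (card (forests r (Suc n) k)) = real (Suc s) * coeff (M * W) n"
          using n by (simp add: mult.left_commute)
        then show ?thesis
          unfolding s j MS W_def[symmetric] by simp
      qed
    qed
  qed simp
qed

section \<open>Closed form and Delannoy recurrence\<close>

text \<open>These are the \<open>S p m\<close>; the factor \<open>[:0, 1:]\<close> replaces the
  index \<open>m - 1\<close> and gives the value 0 at \<open>m = 0\<close>.\<close>

definition delannoy_like :: "nat \<Rightarrow> nat \<Rightarrow> real" where
  "delannoy_like p m = coeff ([:0, 1:] * [:1, 1:] ^ m * [:1, 2:] ^ p) m"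

text \<open>Lagrange inversion for one tree: \<open>[:0, 1, 2:] ^ p\<close> contributes
  \<open>t ^ p\<close>, which shifts the coefficient from \<open>m + p\<close> to
  \<open>m\<close>.\<close>

lemma BoNa_closed_form:
  "real (m + p) * real (BoNa (m + p) (Suc p)) = real ((m + p) choose p) * delannoy_like p m"
proof -
  have B: "[:0, 1, 2 :: real:] = monom 1 1 * [:1, 2:]" and X: "[:0, 1 :: real:] = monom 1 1"
    by (simp_all add: monom_Suc)
  have "monom 1 1 * weight (m + p) (Suc p)
    = of_nat ((m + p) choose p) * (monom 1 p * ([:0, 1:] * [:1, 1:] ^ m * [:1, 2:] ^ p))"
    unfolding binom_coeff_closed_form B X power_mult_distrib
    by (simp add: monom_power mult_ac del: mult_pCons_left mult_pCons_right)
  moreover have "coeff (of_nat c * (monom 1 p * Q)) (m + p) = real c * coeff Q m"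
    for c and Q :: "real poly"
    by (simp add: of_nat_poly coeff_monom_mult)
  ultimately show ?thesis
    unfolding BoNa_eq_card_forests lagrange_forests[of "m + p" 1] delannoy_like_def
    by (simp only: of_nat_1 mult_1)
qed

lemma delannoy_like_0_right: "delannoy_like p 0 = 0"
  by (simp add: delannoy_like_def)

lemma delannoy_like_0_left: "delannoy_like 0 m = real m"
proof (cases m)
  case (Suc n)
  have "coeff ([:1, 1 :: real:] ^ Suc n) n = real (Suc n)"
    by (subst coeff_linear_poly_power) auto
  then show ?thesis using Suc by (simp add: delannoy_like_def del: power_Suc)
qed (simp add: delannoy_like_def)

text \<open>Rests on \<open>(1 + t) * (1 + 2 * t) = t * (1 + 2 * t) + (1 + t) + t\<close>.\<close>

lemma delannoy_like_rec:
  "delannoy_like (Suc p) (Suc m) =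
     delannoy_like (Suc p) m + delannoy_like p (Suc m) + delannoy_like p m"
proof -
  define Q where "Q = [:0, 1 :: real:] * [:1, 1:] ^ m * [:1, 2:] ^ p"
  have 1: "delannoy_like (Suc p) (Suc m) = coeff ([:1, 1:] * ([:1, 2:] * Q)) (Suc m)"
    unfolding delannoy_like_def Q_def power_Suc by (simp only: mult_ac)
  have 2: "delannoy_like (Suc p) m = coeff ([:1, 2:] * Q) m"
    unfolding delannoy_like_def Q_def power_Suc by (simp only: mult_ac)
  have 3: "delannoy_like p (Suc m) = coeff ([:1, 1:] * Q) (Suc m)"
    unfolding delannoy_like_def Q_def power_Suc by (simp only: mult_ac)
  have 4: "delannoy_like p m = coeff Q m"
    unfolding delannoy_like_def Q_def ..
  show ?thesis unfolding 1 2 3 4 by (cases m) (simp_all add: coeff_pCons)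
qed

section \<open>Log-concavity of the Delannoy-like rows\<close>

lemma log_concave_partial_sums:
  fixes c d :: "nat \<Rightarrow> real"
  assumes pos: "\<And>i. c i > 0"
    and lc: "\<And>i. c i * c (Suc (Suc i)) \<le> (c (Suc i))\<^sup>2"
    and d: "d 0 = 0" "\<And>i. d (Suc i) = d i + c i"
  shows "d i * d (Suc (Suc i)) \<le> (d (Suc i))\<^sup>2"
proof -
  have nonneg: "d i \<ge> 0" for i
    by (induction i) (auto simp: d intro: add_nonneg_nonneg less_imp_le[OF pos])
  \<comment> \<open>Equivalent to the goal, since \<open>(d (i + 1))^2 - d i * d (i + 2) = d (i + 1)
    * c i - d i * c (i + 1)\<close>.\<close>
  have "d i * c (Suc i) \<le> d (Suc i) * c i"
  proof (induction i)
    case 0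
    show ?case using pos[of 0] by (simp add: d)
  next
    case (Suc i)
    have "c i * (d (Suc i) * c (Suc (Suc i))) \<le> d (Suc i) * (c (Suc i))\<^sup>2"
      using mult_left_mono[OF lc[of i] nonneg[of "Suc i"]] by (simp add: mult_ac)
    also have "\<dots> = c (Suc i) * (d i * c (Suc i) + c i * c (Suc i))"
      by (simp add: d power2_eq_square algebra_simps)
    also have "\<dots> \<le> c (Suc i) * (d (Suc i) * c i + c i * c (Suc i))"
      using Suc pos[of "Suc i"] by (intro mult_left_mono) auto
    also have "\<dots> = c i * (d (Suc (Suc i)) * c (Suc i))"
      by (simp add: d(2)[of "Suc i"] algebra_simps)
    finally show ?case using pos[of i] by simp
  qed
  then show ?thesis
    by (simp add: d(2)[of "Suc i"] power2_eq_square) (simp add: d algebra_simps)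
qed

text \<open>After expansion only the cross term \<open>?x * ?w \<le> ?y * ?z\<close> goes beyond
  \<open>lc\<close>; it follows by multiplying two instances of \<open>lc\<close> and cancelling
  \<open>?y * ?z\<close>.\<close>

lemma log_concave_adjacent_sums:
  fixes a :: "nat \<Rightarrow> real"
  assumes nonneg: "a 0 \<ge> 0" and pos: "\<And>i. a (Suc i) > 0"
    and lc: "\<And>i. a i * a (Suc (Suc i)) \<le> (a (Suc i))\<^sup>2"
  shows "(a i + a (Suc i)) * (a (Suc (Suc i)) + a (Suc (Suc (Suc i))))
    \<le> (a (Suc i) + a (Suc (Suc i)))\<^sup>2"
proof -
  let ?x = "a i" and ?y = "a (Suc i)" and ?z = "a (Suc (Suc i))" and ?w = "a (Suc (Suc (Suc i)))"
  have x: "?x \<ge> 0" using nonneg pos by (cases i) (auto intro: less_imp_le)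
  have "(?y * ?z) * (?x * ?w) = (?x * ?z) * (?y * ?w)" by simp
  also have "\<dots> \<le> ?y\<^sup>2 * ?z\<^sup>2"
    using lc x pos by (intro mult_mono) (auto intro: less_imp_le)
  also have "\<dots> = (?y * ?z) * (?y * ?z)" by (simp add: power2_eq_square)
  finally have "?x * ?w \<le> ?y * ?z"
    using pos[of i] pos[of "Suc i"] by simp
  then show ?thesis using lc[of i] lc[of "Suc i"]
    by (simp add: power2_eq_square algebra_simps)
qed

lemma delannoy_like_pos: "delannoy_like p (Suc m) > 0"
proof (induction p arbitrary: m)
  case (Suc p)
  show ?case
  proof (induction m)
    case 0
    show ?case using Suc[of 0] by (simp add: delannoy_like_rec delannoy_like_0_right)
  next
    case (Suc m)
    show ?case using Suc \<open>\<And>m. delannoy_like p (Suc m) > 0\<close>[of m]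
        \<open>\<And>m. delannoy_like p (Suc m) > 0\<close>[of "Suc m"]
      by (simp add: delannoy_like_rec[of p "Suc m"])
  qed
qed (simp add: delannoy_like_0_left)

lemma delannoy_like_nonneg: "delannoy_like p m \<ge> 0"
  by (cases m) (auto simp: delannoy_like_0_right intro: less_imp_le delannoy_like_pos)

lemma delannoy_like_log_concave:
  "delannoy_like p i * delannoy_like p (Suc (Suc i)) \<le> (delannoy_like p (Suc i))\<^sup>2"
proof (induction p arbitrary: i)
  case 0
  show ?case by (simp add: delannoy_like_0_left power2_eq_square algebra_simps)
next
  case (Suc p)
  show ?case
  proof (rule log_concave_partial_sums[where c = "\<lambda>i. delannoy_like p i + delannoy_like p (Suc i)"])
    fix i
    show "delannoy_like p i + delannoy_like p (Suc i) > 0"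
      by (intro add_nonneg_pos delannoy_like_nonneg delannoy_like_pos)
    show "(delannoy_like p i + delannoy_like p (Suc i))
        * (delannoy_like p (Suc (Suc i)) + delannoy_like p (Suc (Suc (Suc i))))
      \<le> (delannoy_like p (Suc i) + delannoy_like p (Suc (Suc i)))\<^sup>2"
      by (intro log_concave_adjacent_sums delannoy_like_nonneg delannoy_like_pos Suc)
    show "delannoy_like (Suc p) (Suc i)
      = delannoy_like (Suc p) i + (delannoy_like p i + delannoy_like p (Suc i))"
      by (simp add: delannoy_like_rec)
  qed (rule delannoy_like_0_right)
qed

section \<open>The binomial factor and the product\<close>

definition cofactor :: "nat \<Rightarrow> nat \<Rightarrow> real" where
  "cofactor p m = real ((m + p) choose p) / real (m + p)"

text \<open>By absorption \<open>m + p + 1\<close> cancels against the denominator;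
  \<open>p > 0\<close> keeps \<open>m + p\<close> nonzero at \<open>m = 0\<close>.\<close>

lemma cofactor_Suc:
  assumes "p > 0"
  shows "real (Suc m) * cofactor p (Suc m) = real (m + p) * cofactor p m"
proof -
  have "Suc m * (Suc (m + p) choose p) = Suc (m + p) * ((m + p) choose p)"
    using Suc_times_binomial_eq[of "m + p" m] binomial_symmetric[of p "m + p"]
      binomial_symmetric[of p "Suc (m + p)"] by (simp add: Suc_diff_le mult.commute)
  then have "real (Suc m) * real (Suc (m + p) choose p) = real (Suc (m + p)) * real ((m + p) choose p)"
    by (metis of_nat_mult)
  then show ?thesis using assms
    by (simp add: cofactor_def divide_simps del: of_nat_Suc binomial_Suc_Suc)
qed

lemma cofactor_log_concave:
  assumes "p > 0"
  shows "cofactor p m * cofactor p (Suc (Suc m)) \<le> (cofactor p (Suc m))\<^sup>2"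
proof -
  let ?x = "cofactor p m" and ?y = "cofactor p (Suc m)" and ?z = "cofactor p (Suc (Suc m))"
  have y: "real (m + p) * ?x = real (m + 1) * ?y"
    using cofactor_Suc[OF assms, of m] by simp
  have z: "real (m + 2) * ?z = real (m + 1 + p) * ?y"
    using cofactor_Suc[OF assms, of "Suc m"] by simp
  have "(real (m + p) * real (m + 2)) * (?x * ?z) = (real (m + p) * ?x) * (real (m + 2) * ?z)"
    by simp
  also have "\<dots> = (real (m + 1) * real (m + 1 + p)) * ?y\<^sup>2"
    unfolding y z by (simp add: power2_eq_square)
  \<comment> \<open>The two products differ by \<open>p - 1\<close>.\<close>
  also have "\<dots> \<le> (real (m + p) * real (m + 2)) * ?y\<^sup>2"
    using assms by (intro mult_right_mono) (auto simp: algebra_simps)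
  finally show ?thesis using assms by (simp add: mult_le_cancel_left_pos)
qed

theorem theorem8p1:
  fixes k :: nat
  assumes "k > 1"
  shows "log_concave_on {k + 1..} (\<lambda>n. real (BoNa n k))"
proof -
  obtain p where k: "k = Suc p" and p: "p > 0"
    using assms by (cases k) auto
  have B: "real (BoNa (m + p) k) = cofactor p m * delannoy_like p m" for m
    using BoNa_closed_form[of m p] p by (simp add: k cofactor_def field_simps)
  have "real (BoNa n k) * real (BoNa (Suc (Suc n)) k) \<le> (real (BoNa (Suc n) k))\<^sup>2"
    if "n \<ge> k + 1" for n
  proof -
    \<comment> \<open>The subtraction is exact because \<open>n \<ge> k + 1 > p\<close>.\<close>
    have "n = (n - p) + p" using that k by simp
    then obtain m where n: "n = m + p" ..
    have "(cofactor p m * cofactor p (Suc (Suc m)))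
        * (delannoy_like p m * delannoy_like p (Suc (Suc m)))
      \<le> (cofactor p (Suc m))\<^sup>2 * (delannoy_like p (Suc m))\<^sup>2"
      by (intro mult_mono cofactor_log_concave delannoy_like_log_concave p
            zero_le_power2 mult_nonneg_nonneg delannoy_like_nonneg)
    then show ?thesis
      using B[of m] B[of "Suc m"] B[of "Suc (Suc m)"]
      by (simp add: n power_mult_distrib mult_ac)
  qed
  then show ?thesis by (simp add: log_concave_on_def)
qed

end
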